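(* Let $m,n$ be positive integers and $\mathbf{r}=(r_1,\ldots,r_n)$ an $n$-tuple of non-negative integers with $r_1+\cdots+r_n=m$; let $S_k=\sum_{i=1}^k r_i$ ($S_0=0$). Then $$\sum_{\pi\in PP^n_{\mathbf{r}}(m\times m)} q^{|\pi|_n}t^{|\pi|_d}=\prod_{i=1}^{m}(1+q^{2i-2}t)\cdot q^{2\alpha}\cdot t^{\beta}\cdot\frac{\prod_{1\le i<j\le n}[S_j-S_i+j-i]_{q^2}\cdot\prod_{i=1}^{n}[S_n+i-1]_{q^2}!}{\prod_{i=1}^{n}[S_i+i-1]_{q^2}!\,[S_n-S_i+n-i]_{q^2}!},$$ where $\alpha=\sum_{i=1}^{n}\binom{S_n-S_i}{2}$ and $\beta=\sum_{i=1}^{n}(S_n-S_i)$.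
   Context: $PP^n(m\times m)$ is the set of $m\times m$ arrays $\pi=(\pi_{i,j})$ of non-negative integers with $\pi_{i,j}\le n$, weakly decreasing along rows and columns. A plane partition $\pi\in PP^n(m\times m)$ is $\mathbf{r}$-block symmetric if $\pi_{i,j}=\pi_{j,i}$ for all $i,j$ and, for each $k=1,\ldots,n$, $\pi_{i,i}\in\{k-1,k\}$ whenever $i\in[S_n-S_{k-1}]\setminus[S_n-S_k]$, where $[N]=\{1,\ldots,N\}$ and $[0]=\emptyset$. $PP^n_{\mathbf{r}}(m\times m)$ denotes the set of such plane partitions. $|\pi|_d=\sum_i\pi_{i,i}$ and $|\pi|_n=\sum_{i\ne j}\pi_{i,j}$. Notation: $[k]_q=\frac{1-q^k}{1-q}$, $[k]_q!=[k]_q\cdots[1]_q$, $[0]_q!=1$, and $[k]_{q^2}$, $[k]_{q^2}!$ denote these with $q$ replaced by $q^2$. *)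

theory Defs
  imports
    "HOL-Library.FuncSet"
    "HOL-Computational_Algebra.Polynomial"
    "HOL-Computational_Algebra.Fraction_Field"
begin

definition plane_partitions :: "nat \<Rightarrow> nat \<Rightarrow> (nat \<times> nat \<Rightarrow> nat) set" where
  "plane_partitions n m = {\<pi> \<in> ({1..m} \<times> {1..m}) \<rightarrow>\<^sub>E {0..n}.
     (\<forall>i\<in>{1..m}. \<forall>j\<in>{1..m}. \<forall>j'\<in>{1..m}. j \<le> j' \<longrightarrow> \<pi> (i, j') \<le> \<pi> (i, j)) \<and>
     (\<forall>j\<in>{1..m}. \<forall>i\<in>{1..m}. \<forall>i'\<in>{1..m}. i \<le> i' \<longrightarrow> \<pi> (i', j) \<le> \<pi> (i, j))}"

text \<open>A tuple \<open>(r\<^sub>1, \<dots>, r\<^sub>n)\<close> is a function on \<open>nat\<close> of which only the values at \<open>1, \<dots>, n\<close> are used.\<close>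

definition psum :: "(nat \<Rightarrow> nat) \<Rightarrow> nat \<Rightarrow> nat" where
  "psum r k = (\<Sum>i = 1..k. r i)"

text \<open>\<open>psum r\<close> is monotone, so no natural-number subtraction below truncates.\<close>

definition block_symmetric ::
    "nat \<Rightarrow> nat \<Rightarrow> (nat \<Rightarrow> nat) \<Rightarrow> (nat \<times> nat \<Rightarrow> nat) \<Rightarrow> bool" where
  "block_symmetric n m r \<pi> \<longleftrightarrow>
     (\<forall>i\<in>{1..m}. \<forall>j\<in>{1..m}. \<pi> (i, j) = \<pi> (j, i)) \<and>
     (\<forall>k\<in>{1..n}. \<forall>i \<in> {1..psum r n - psum r (k - 1)} - {1..psum r n - psum r k}.
        \<pi> (i, i) \<in> {k - 1, k})"

definition block_symmetric_pps ::
    "nat \<Rightarrow> nat \<Rightarrow> (nat \<Rightarrow> nat) \<Rightarrow> (nat \<times> nat \<Rightarrow> nat) set" where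
  "block_symmetric_pps n m r = {\<pi> \<in> plane_partitions n m. block_symmetric n m r \<pi>}"

definition diag_size :: "nat \<Rightarrow> (nat \<times> nat \<Rightarrow> nat) \<Rightarrow> nat" where
  "diag_size m \<pi> = (\<Sum>i = 1..m. \<pi> (i, i))"

definition nondiag_size :: "nat \<Rightarrow> (nat \<times> nat \<Rightarrow> nat) \<Rightarrow> nat" where
  "nondiag_size m \<pi> = (\<Sum>(i, j) \<in> {(i, j). i \<in> {1..m} \<and> j \<in> {1..m} \<and> i \<noteq> j}. \<pi> (i, j))"

definition qnum :: "'a::field \<Rightarrow> nat \<Rightarrow> 'a" where
  "qnum q k = (1 - q ^ k) / (1 - q)"

definition qfact :: "'a::field \<Rightarrow> nat \<Rightarrow> 'a" where
  "qfact q k = (\<Prod>i = 1..k. qnum q i)"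

text \<open>The field of rational functions in two indeterminates, as the fraction field of
  \<open>\<int>[q][t]\<close>: the inner polynomial variable is \<open>q\<close>, the outer one is \<open>t\<close>.\<close>

type_synonym ratfun = "int poly poly fract"

definition q_var :: ratfun where
  "q_var = Fract [:[:0, 1:]:] 1"

definition t_var :: ratfun where
  "t_var = Fract [:0, 1:] 1"

end

theory Submission
  imports Defs "Jordan_Normal_Form.Determinant"
begin


text \<open>A symmetric array is determined by its diagonal \<open>a\<close> and the entries above
  it, and the latter count twice in the off-diagonal size. With u = q^2 the left side is therefore
  the sum over admissible \<open>a\<close> of t^|a| times the generating function in u of the
  triangles with diagonal \<open>a\<close> (\<open>sum_block_symmetric_pps\<close>). Successive
  superdiagonals of a triangle interlace, so it is a Gelfand-Tsetlin pattern, and the generating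
  function is the Schur polynomial s_a at (1, u, ..., u^(m-1)), a quotient of two alternants
  (\<open>sum_triangles_alternant\<close>).

  Block symmetry means that \<open>a\<close> is weakly decreasing with each a_i equal to mu_i or
  mu_i + 1, where mu = \<open>level S n\<close> is the conjugate of the partition (S_n - S_1, ...,
  S_n - S_n); so a/mu is a vertical strip. The dual Pieri rule then yields s_mu t^|mu| times the
  product of the 1 + u^j t, and |mu| = \<beta>. In terms of determinants: choices that are not
  weakly decreasing produce two equal rows, so all independent choices may be summed, and
  multilinearity turns the sum into column factors (\<open>sum_alternant_vertical_strips\<close>).

  It remains to evaluate s_mu. The Vandermonde determinant gives u^\<alpha> and q-integers of
  differences of the shifted parts of mu. These parts and the numbers S_k + k - 1 together fill {0,
  ..., m + n - 1} (\<open>shifted_levels_complement\<close>), so the product over the m parts can be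
  traded for one over the n complementary numbers (\<open>qvandermonde_complement\<close>), which is
  the stated quotient (\<open>alternant_level\<close>).\<close>

section \<open>Determinant identities\<close>

lemma det_subtract_previous_row:
  fixes f :: "nat \<Rightarrow> nat \<Rightarrow> 'a :: comm_ring_1"
  shows "det (mat n n (\<lambda>(i, j). if i = 0 then f 0 j else f i j - c * f (i - 1) j)) =
    det (mat n n (\<lambda>(i, j). f i j))"
proof -
  define L :: "'a mat" where
    "L = mat n n (\<lambda>(i, j). if i = j then 1 else if i = Suc j then - c else 0)"
  define A where "A = mat n n (\<lambda>(i, j). f i j)"
  have L: "L \<in> carrier_mat n n" and A: "A \<in> carrier_mat n n"
    by (auto simp: L_def A_def)
  have "det L = 1"
    by (subst det_lower_triangular[OF _ L]) (auto simp: L_def prod_list_diag_prod)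
  moreover have "mat n n (\<lambda>(i, j). if i = 0 then f 0 j else f i j - c * f (i - 1) j) = L * A"
  proof (rule eq_matI)
    fix i j assume ij: "i < dim_row (L * A)" "j < dim_col (L * A)"
    hence i: "i < n" and j: "j < n" using L A by auto
    have "(L * A) $$ (i, j) =
        (\<Sum>k = 0..<n. (if i = k then 1 else if i = Suc k then - c else 0) * f k j)"
      using i j by (simp add: L_def A_def scalar_prod_def)
    also have "\<dots> = (\<Sum>k = 0..<n. (if k = i then f k j else 0) +
        (if k = i - 1 then if i = 0 then 0 else - c * f k j else 0))"
      by (intro sum.cong) auto
    also have "\<dots> = (if i = 0 then f 0 j else f i j - c * f (i - 1) j)"
      using i by (auto simp: sum.distrib)
    finally show "mat n n (\<lambda>(i, j). if i = 0 then f 0 j else f i j - c * f (i - 1) j) $$ (i, j) =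
        (L * A) $$ (i, j)"
      using i j by simp
  qed (use L A in auto)
  ultimately show ?thesis
    using det_mult[OF L A] by (simp add: A_def)
qed

lemma det_first_column_zero:
  fixes f :: "nat \<Rightarrow> nat \<Rightarrow> 'a :: comm_ring_1"
  assumes "\<And>i. 0 < i \<Longrightarrow> i \<le> n \<Longrightarrow> f i 0 = 0"
  shows "det (mat (Suc n) (Suc n) (\<lambda>(i, j). f i j)) =
    f 0 0 * det (mat n n (\<lambda>(i, j). f (Suc i) (Suc j)))"
proof -
  define A where "A = mat (Suc n) (Suc n) (\<lambda>(i, j). f i j)"
  have A: "A \<in> carrier_mat (Suc n) (Suc n)"
    by (simp add: A_def)
  have "det A = (\<Sum>i<Suc n. A $$ (i, 0) * cofactor A i 0)"
    by (rule laplace_expansion_column[OF A]) simp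
  also have "\<dots> = A $$ (0, 0) * cofactor A 0 0"
    by (subst sum.lessThan_Suc_shift) (auto simp: A_def assms)
  also have "mat_delete A 0 0 = mat n n (\<lambda>(i, j). f (Suc i) (Suc j))"
    by (rule eq_matI) (auto simp: mat_delete_def A_def)
  hence "cofactor A 0 0 = det (mat n n (\<lambda>(i, j). f (Suc i) (Suc j)))"
    by (simp add: cofactor_def)
  finally show ?thesis
    by (simp add: A_def)
qed

lemma det_mult_columns:
  fixes f :: "nat \<Rightarrow> nat \<Rightarrow> 'a :: comm_ring_1"
  shows "det (mat n n (\<lambda>(i, j). f i j * c j)) =
    (\<Prod>j<n. c j) * det (mat n n (\<lambda>(i, j). f i j))"
proof -
  have "signof p * (\<Prod>i = 0..<n. f i (p i) * c (p i)) =
      (\<Prod>j<n. c j) * (signof p * (\<Prod>i = 0..<n. f i (p i)))"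
    if "p permutes {0..<n}" for p
    using prod.permute[OF that, of c]
    by (simp add: prod.distrib lessThan_atLeast0 o_def algebra_simps)
  thus ?thesis
    by (subst (1 2) det_def') (auto simp: sum_distrib_left intro!: sum.cong)
qed

lemma det_mult_rows:
  fixes f :: "nat \<Rightarrow> nat \<Rightarrow> 'a :: comm_ring_1"
  shows "det (mat n n (\<lambda>(i, j). c i * f i j)) =
    (\<Prod>i<n. c i) * det (mat n n (\<lambda>(i, j). f i j))"
  by (subst (1 2) det_def')
     (auto simp: sum_distrib_left prod.distrib lessThan_atLeast0 algebra_simps intro!: sum.cong)

text \<open>Multilinearity in the rows, in the form that produces the sums over interlacing
  sequences and over vertical strips.\<close>

lemma det_sum_rows:
  fixes g :: "nat \<Rightarrow> 'b \<Rightarrow> nat \<Rightarrow> 'a :: comm_ring_1"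
  assumes "\<And>i. i < n \<Longrightarrow> finite (B i)"
  shows "det (mat n n (\<lambda>(i, j). \<Sum>x\<in>B i. g i x j)) =
    (\<Sum>b\<in>PiE {0..<n} B. det (mat n n (\<lambda>(i, j). g i (b i) j)))"
proof -
  have "signof p * (\<Prod>i = 0..<n. \<Sum>x\<in>B i. g i x (p i)) =
      (\<Sum>b\<in>PiE {0..<n} B. signof p * (\<Prod>i = 0..<n. g i (b i) (p i)))"
    if "p permutes {0..<n}" for p
    by (subst prod_sum_PiE) (auto simp: assms sum_distrib_left)
  hence "det (mat n n (\<lambda>(i, j). \<Sum>x\<in>B i. g i x j)) = 
    (\<Sum>p | p permutes {0..<n}. \<Sum>b\<in>PiE {0..<n} B. signof p * (\<Prod>i = 0..<n. g i (b i) (p i)))"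
    by (subst det_def') (auto intro!: sum.cong)
  also have "\<dots> = (\<Sum>b\<in>PiE {0..<n} B. det (mat n n (\<lambda>(i, j). g i (b i) j)))"
    by (subst sum.swap) (auto simp: det_def intro!: sum.cong)
  finally show ?thesis .
qed

text \<open>In the transpose, subtracting \<open>x 0\<close> times the previous row clears the first
  column below its top entry. Each other column then has the factor \<open>x (Suc i) - x 0\<close>,
  and the Vandermonde determinant of the remaining variables is left.\<close>

lemma det_vandermonde:
  fixes x :: "nat \<Rightarrow> 'a :: comm_ring_1"
  shows "det (mat n n (\<lambda>(i, j). x i ^ j)) = (\<Prod>j<n. \<Prod>i<j. x j - x i)"
proof (induction n arbitrary: x)
  case (Suc n)
  have "det (mat (Suc n) (Suc n) (\<lambda>(i, j). x i ^ j)) =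
      det (mat (Suc n) (Suc n) (\<lambda>(j, i). x i ^ j))"
    by (subst det_transpose[symmetric, of _ "Suc n"])
       (auto intro!: arg_cong[of _ _ det] eq_matI)
  also have "\<dots> = det (mat (Suc n) (Suc n) (\<lambda>(j, i).
      if j = 0 then 1 else x i ^ j - x 0 * x i ^ (j - 1)))"
    by (subst det_subtract_previous_row[where c = "x 0", symmetric])
       (auto intro!: arg_cong[of _ _ det] eq_matI)
  also have "\<dots> = det (mat n n (\<lambda>(j, i). x (Suc i) ^ Suc j - x 0 * x (Suc i) ^ j))"
    by (subst det_first_column_zero) (auto simp flip: power_Suc)
  also have "\<dots> = det (mat n n (\<lambda>(j, i). x (Suc i) ^ j * (x (Suc i) - x 0)))"
    by (simp add: algebra_simps)
  also have "\<dots> = (\<Prod>i<n. x (Suc i) - x 0) * det (mat n n (\<lambda>(j, i). x (Suc i) ^ j))"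
    by (rule det_mult_columns)
  also have "det (mat n n (\<lambda>(j, i). x (Suc i) ^ j)) = det (mat n n (\<lambda>(i, j). x (Suc i) ^ j))"
    by (subst det_transpose[symmetric, of _ n])
       (auto intro!: arg_cong[of _ _ det] eq_matI)
  also have "\<dots> = (\<Prod>j<n. \<Prod>i<j. x (Suc j) - x (Suc i))"
    by (rule Suc.IH)
  finally show ?case
    by (simp add: prod.lessThan_Suc_shift prod.distrib del: prod.lessThan_Suc)
qed auto

subsection \<open>Alternants and triangles with given diagonal\<close>

text \<open>With \<open>x\<^sub>j = u\<^sup>j\<close> this is the alternant \<open>det (x\<^sub>j\<^bsup>a\<^sub>i + n - 1 - i\<^esup>)\<close> of the bialternant formula.\<close>

definition alternant :: "'a :: comm_ring_1 \<Rightarrow> nat \<Rightarrow> (nat \<Rightarrow> nat) \<Rightarrow> 'a" where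
  "alternant u n a = det (mat n n (\<lambda>(i, j). u ^ ((a i + (n - 1 - i)) * j)))"

lemma alternant_cong:
  "(\<And>i. i < n \<Longrightarrow> a i = b i) \<Longrightarrow> alternant u n a = alternant u n b"
  unfolding alternant_def by (intro arg_cong[of _ _ det] eq_matI) auto

text \<open>Differences of consecutive rows are geometric sums over the interlacing entries.\<close>

lemma alternant_interlacing:
  assumes "\<And>i. i < n \<Longrightarrow> a (Suc i) \<le> a i"
  shows "alternant u (Suc n) a =
    (\<Prod>j<n. 1 - u ^ Suc j) * (\<Prod>i<n. u ^ (n - 1 - i)) *
    (\<Sum>b\<in>PiE {0..<n} (\<lambda>i. {a (Suc i)..a i}). u ^ (\<Sum>i<n. b i) * alternant u n b)"
proof -
  \<comment> \<open>Consecutive exponents differ by \<open>a i - a (Suc i) + 1\<close>, the number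
    of integers from \<open>a (Suc i)\<close> to \<open>a i\<close>; hence the geometric sum below
    has exactly the interlacing values as its index set.\<close>
  define e where "e i = a i + (n - i)" for i
  have geometric: "u ^ (e (Suc i) * Suc j) - u ^ (e i * Suc j) =
      (\<Sum>x = a (Suc i)..a i. u ^ (Suc j * (x + (n - 1 - i)))) * (1 - u ^ Suc j)"
    if "i < n" for i j
  proof -
    define y where "y = u ^ Suc j"
    define k where "k = n - 1 - i"
    have e: "e (Suc i) = a (Suc i) + k" "e i = Suc (a i) + k"
      using that by (auto simp: e_def k_def)
    have "(\<Sum>x = a (Suc i)..a i. y ^ (x + k)) * (1 - y) =
        y ^ k * ((1 - y) * (\<Sum>x = a (Suc i)..a i. y ^ x))"
      by (simp add: power_add flip: sum_distrib_right)
    also have "\<dots> = y ^ e (Suc i) - y ^ e i"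
      unfolding sum_gp_multiplied[OF assms[OF that]] e by (simp add: power_add algebra_simps)
    finally show ?thesis
      by (simp only: y_def k_def power_mult[symmetric] mult.commute[of "Suc j"])
  qed
  \<comment> \<open>The exponent multiplier \<open>Suc j\<close> exceeds the alternant's
    \<open>j\<close> by one; the surplus is a factor of the row and supplies the weight of
    \<open>b\<close>.\<close>
  have factor: "det (mat n n (\<lambda>(i, j). u ^ (Suc j * (b i + (n - 1 - i))))) =
      (\<Prod>i<n. u ^ (n - 1 - i)) * (u ^ (\<Sum>i<n. b i) * alternant u n b)" for b
  proof -
    have "det (mat n n (\<lambda>(i, j). u ^ (Suc j * (b i + (n - 1 - i))))) =
        det (mat n n (\<lambda>(i, j). u ^ (b i + (n - 1 - i)) * u ^ ((b i + (n - 1 - i)) * j)))"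
      by (intro arg_cong[of _ _ det] eq_matI)
         (auto simp: mult.commute simp flip: power_add)
    also have "\<dots> = (\<Prod>i<n. u ^ (b i + (n - 1 - i))) * alternant u n b"
      unfolding alternant_def by (rule det_mult_rows)
    also have "(\<Prod>i<n. u ^ (b i + (n - 1 - i))) = (\<Prod>i<n. u ^ (n - 1 - i)) * u ^ (\<Sum>i<n. b i)"
      by (simp only: power_add prod.distrib power_sum mult.commute)
    finally show ?thesis
      by (simp only: mult.assoc)
  qed
  have "alternant u (Suc n) a = det (mat (Suc n) (Suc n) (\<lambda>(i, j). u ^ (e i * j)))"
    by (simp add: alternant_def e_def)
  also have "\<dots> = det (mat (Suc n) (Suc n) (\<lambda>(i, j).
      if i = 0 then u ^ (e 0 * j) else u ^ (e i * j) - 1 * u ^ (e (i - 1) * j)))"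
    by (subst det_subtract_previous_row[of "Suc n" "\<lambda>i j. u ^ (e i * j)" 1]) simp
  \<comment> \<open>Column 0 consists of ones, so the row differences leave only its top
    entry.\<close>
  also have "\<dots> = det (mat n n (\<lambda>(i, j). u ^ (e (Suc i) * Suc j) - u ^ (e i * Suc j)))"
    by (subst det_first_column_zero) auto
  also have "\<dots> = det (mat n n (\<lambda>(i, j).
      (\<Sum>x = a (Suc i)..a i. u ^ (Suc j * (x + (n - 1 - i)))) * (1 - u ^ Suc j)))"
    by (intro arg_cong[of _ _ det] eq_matI) (auto simp only: geometric index_mat dim_row_mat dim_col_mat prod.case)
  also have "\<dots> = (\<Prod>j<n. 1 - u ^ Suc j) *
      (\<Sum>b\<in>PiE {0..<n} (\<lambda>i. {a (Suc i)..a i}).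
        det (mat n n (\<lambda>(i, j). u ^ (Suc j * (b i + (n - 1 - i))))))"
    by (subst det_mult_columns, subst det_sum_rows) auto
  finally show ?thesis
    by (simp only: factor sum_distrib_left[symmetric] mult.assoc)
qed

section \<open>Triangles as Gelfand-Tsetlin patterns\<close>

text \<open>Indices start at 0. The codomain is \<open>UNIV\<close> because monotonicity along rows
  already bounds each entry by a diagonal entry.\<close>

definition triangles :: "nat \<Rightarrow> (nat \<Rightarrow> nat) \<Rightarrow> (nat \<times> nat \<Rightarrow> nat) set" where
  "triangles n a = {T \<in> {(i, j). i \<le> j \<and> j < n} \<rightarrow>\<^sub>E UNIV.
     (\<forall>i<n. T (i, i) = a i) \<and>
     (\<forall>i j j'. i \<le> j \<and> j \<le> j' \<and> j' < n \<longrightarrow> T (i, j') \<le> T (i, j)) \<and>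
     (\<forall>i i' j. i \<le> i' \<and> i' \<le> j \<and> j < n \<longrightarrow> T (i', j) \<le> T (i, j))}"

definition upper_size :: "nat \<Rightarrow> (nat \<times> nat \<Rightarrow> nat) \<Rightarrow> nat" where
  "upper_size n T = (\<Sum>j<n. \<Sum>i<j. T (i, j))"

lemma upper_size_Suc:
  "upper_size (Suc n) T = (\<Sum>i<n. T (i, Suc i)) + upper_size n (\<lambda>(i, j). T (i, Suc j))"
  by (simp add: upper_size_def sum.lessThan_Suc_shift[of _ n] sum.distrib del: sum.lessThan_Suc)
     (simp add: sum.distrib)

lemma upper_size_cong:
  "(\<And>i j. i < j \<Longrightarrow> j < n \<Longrightarrow> T (i, j) = T' (i, j)) \<Longrightarrow> upper_size n T = upper_size n T'"
  unfolding upper_size_def by (intro sum.cong) auto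

lemma triangles_0: "triangles 0 a = {\<lambda>_. undefined}"
  by (auto simp: triangles_def)

definition extend_triangle :: "nat \<Rightarrow> (nat \<Rightarrow> nat) \<Rightarrow> (nat \<times> nat \<Rightarrow> nat) \<Rightarrow> nat \<times> nat \<Rightarrow> nat" where
  "extend_triangle n a T = restrict (\<lambda>(i, j). if i = j then a i else T (i, j - 1))
     {(i, j). i \<le> j \<and> j < Suc n}"

text \<open>Stripping the main diagonal leaves a triangle whose diagonal is the former first
  superdiagonal \<open>b\<close>. All conditions that involve \<open>a\<close> reduce to the
  interlacing of \<open>b\<close> with \<open>a\<close>, because \<open>b\<close> bounds the
  remaining entries.\<close>

lemma triangles_Suc:
  assumes "\<And>i. i < n \<Longrightarrow> a (Suc i) \<le> a i"
  shows "bij_betw (\<lambda>(b, T). extend_triangle n a T)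
    (SIGMA b : PiE {0..<n} (\<lambda>i. {a (Suc i)..a i}). triangles n b) (triangles (Suc n) a)"
proof (rule bij_betw_byWitness[where f' = "\<lambda>T. (restrict (\<lambda>i. T (i, Suc i)) {0..<n},
    restrict (\<lambda>(i, j). T (i, Suc j)) {(i, j). i \<le> j \<and> j < n})"])
  let ?back = "\<lambda>T. (restrict (\<lambda>i. T (i, Suc i)) {0..<n},
    restrict (\<lambda>(i, j). T (i, Suc j)) {(i, j). i \<le> j \<and> j < n})"
  let ?S = "SIGMA b : PiE {0..<n} (\<lambda>i. {a (Suc i)..a i}). triangles n b"
  have "?back (extend_triangle n a T) = (b, T)"
    if b: "b \<in> PiE {0..<n} (\<lambda>i. {a (Suc i)..a i})" and T: "T \<in> triangles n b" for b T
  proof -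
    have "restrict (\<lambda>i. extend_triangle n a T (i, Suc i)) {0..<n} = b"
      using T by (intro extensionalityI[of _ "{0..<n}"] PiE_ext)
        (use b in \<open>auto simp: extend_triangle_def triangles_def PiE_def\<close>)
    moreover have "restrict (\<lambda>(i, j). extend_triangle n a T (i, Suc j)) {(i, j). i \<le> j \<and> j < n} = T"
      using T by (intro extensionalityI[of _ "{(i, j). i \<le> j \<and> j < n}"])
        (auto simp: extend_triangle_def triangles_def PiE_def)
    ultimately show ?thesis by simp
  qed
  thus "\<forall>p\<in>?S. ?back ((\<lambda>(b, T). extend_triangle n a T) p) = p"
    by auto
  show "\<forall>T\<in>triangles (Suc n) a. (\<lambda>(b, T). extend_triangle n a T) (?back T) = T"
  proof
    fix T assume T: "T \<in> triangles (Suc n) a"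
    show "(\<lambda>(b, T). extend_triangle n a T) (?back T) = T"
      using T by (intro extensionalityI[of _ "{(i, j). i \<le> j \<and> j < Suc n}"])
        (auto simp: extend_triangle_def triangles_def PiE_def)
  qed
  have "extend_triangle n a T \<in> triangles (Suc n) a"
    if b: "b \<in> PiE {0..<n} (\<lambda>i. {a (Suc i)..a i})" and T: "T \<in> triangles n b" for b T
  proof -
    have diag: "T (i, i) = b i" if "i < n" for i
      using T that by (auto simp: triangles_def)
    have row: "T (i, j') \<le> T (i, j)" if "i \<le> j" "j \<le> j'" "j' < n" for i j j'
      using T that by (auto simp: triangles_def)
    have col: "T (i', j) \<le> T (i, j)" if "i \<le> i'" "i' \<le> j" "j < n" for i i' j
      using T that by (auto simp: triangles_def)
    \<comment> \<open>An entry is at most the diagonal entry of its row and at least that of its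
      column; interlacing then compares it with the new diagonal.\<close>
    have upper: "T (i, j) \<le> a i" if "i \<le> j" "j < n" for i j
      using row[of i i j] diag[of i] PiE_mem[OF b, of i] that by auto
    have lower: "a (Suc j) \<le> T (i, j)" if "i \<le> j" "j < n" for i j
      using col[of i j j] diag[of j] PiE_mem[OF b, of j] that by auto
    show ?thesis
      unfolding triangles_def
    proof (intro CollectI conjI allI impI)
      show "extend_triangle n a T (i, j') \<le> extend_triangle n a T (i, j)"
        if "i \<le> j \<and> j \<le> j' \<and> j' < Suc n" for i j j'
        using that by (auto simp: extend_triangle_def intro!: row upper)
      show "extend_triangle n a T (i', j) \<le> extend_triangle n a T (i, j)"
        if "i \<le> i' \<and> i' \<le> j \<and> j < Suc n" for i i' j
        using that lower[of i "j - 1"] by (auto simp: extend_triangle_def intro!: col)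
    qed (auto simp: extend_triangle_def)
  qed
  thus "(\<lambda>(b, T). extend_triangle n a T) ` ?S \<subseteq> triangles (Suc n) a"
    by auto
  show "?back ` triangles (Suc n) a \<subseteq> ?S"
  proof
    fix p assume "p \<in> ?back ` triangles (Suc n) a"
    then obtain T where T: "T \<in> triangles (Suc n) a" and p: "p = ?back T"
      by auto
    have "a (Suc i) \<le> T (i, Suc i)" "T (i, Suc i) \<le> a i" if "i < n" for i
    proof -
      have "T (i', j) \<le> T (i, j)" if "i \<le> i'" "i' \<le> j" "j < Suc n" for i i' j
        using T that by (auto simp: triangles_def)
      from this[of i "Suc i" "Suc i"] have "T (Suc i, Suc i) \<le> T (i, Suc i)"
        using that by simp
      moreover have "T (i, j') \<le> T (i, j)" if "i \<le> j" "j \<le> j'" "j' < Suc n" for i j j'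
        using T that by (auto simp: triangles_def)
      from this[of i i "Suc i"] have "T (i, Suc i) \<le> T (i, i)"
        using that by simp
      moreover have "T (Suc i, Suc i) = a (Suc i)" "T (i, i) = a i"
        using T that by (auto simp: triangles_def)
      ultimately show "a (Suc i) \<le> T (i, Suc i)" "T (i, Suc i) \<le> a i"
        by simp_all
    qed
    thus "p \<in> ?S"
      using T by (auto simp: p triangles_def)
  qed
qed

lemma finite_triangles:
  assumes "\<And>i. Suc i < n \<Longrightarrow> a (Suc i) \<le> a i"
  shows "finite (triangles n a)"
  using assms
proof (induction n arbitrary: a)
  case (Suc n)
  have "b (Suc i) \<le> b i"
    if "b \<in> PiE {0..<n} (\<lambda>i. {a (Suc i)..a i})" "Suc i < n" for b i
    using PiE_mem[OF that(1), of i] PiE_mem[OF that(1), of "Suc i"] that(2) by auto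
  hence "finite (triangles n b)" if "b \<in> PiE {0..<n} (\<lambda>i. {a (Suc i)..a i})" for b
    using that by (intro Suc.IH)
  hence "finite (SIGMA b : PiE {0..<n} (\<lambda>i. {a (Suc i)..a i}). triangles n b)"
    by (intro finite_SigmaI finite_PiE) simp_all
  thus ?case
    using bij_betw_finite[OF triangles_Suc[of n a]] Suc.prems by auto
qed (simp add: triangles_0)

text \<open>The bialternant formula at x_j = u^j, cleared of denominators so that it makes sense in
  any commutative ring. Stripping diagonals and \<open>alternant_interlacing\<close> give the two
  sides the same recursion.\<close>

theorem sum_triangles_alternant:
  fixes u :: "'a :: comm_ring_1"
  assumes "\<And>i. Suc i < n \<Longrightarrow> a (Suc i) \<le> a i"
  shows "(\<Sum>T\<in>triangles n a. u ^ upper_size n T) * alternant u n (\<lambda>_. 0) = alternant u n a"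
  using assms
proof (induction n arbitrary: a)
  case 0
  show ?case
    by (simp add: triangles_0 upper_size_def alternant_def)
next
  case (Suc n)
  define B where "B = PiE {0..<n} (\<lambda>i. {a (Suc i)..a i})"
  define K where "K = (\<Prod>j<n. 1 - u ^ Suc j) * (\<Prod>i<n. u ^ (n - 1 - i))"
  have mono: "b (Suc i) \<le> b i" if "b \<in> B" "Suc i < n" for b i
    using PiE_mem[OF that(1)[unfolded B_def], of i] 
      PiE_mem[OF that(1)[unfolded B_def], of "Suc i"] that(2) by auto
  have [simp]: "finite B"
    by (auto simp: B_def intro!: finite_PiE)
  have "(\<Sum>T\<in>triangles (Suc n) a. u ^ upper_size (Suc n) T) =
      (\<Sum>(b, T)\<in>(SIGMA b : B. triangles n b). u ^ upper_size (Suc n) (extend_triangle n a T))"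
    using Suc.prems
    unfolding B_def
    by (subst sum.reindex_bij_betw[OF triangles_Suc, symmetric]) (simp_all add: case_prod_beta)
  also have "\<dots> = (\<Sum>b\<in>B. \<Sum>T\<in>triangles n b. u ^ upper_size (Suc n) (extend_triangle n a T))"
    by (rule sum.Sigma[symmetric]) (simp, intro ballI finite_triangles mono)
  also have "\<dots> = (\<Sum>b\<in>B. \<Sum>T\<in>triangles n b. u ^ (\<Sum>i<n. b i) * u ^ upper_size n T)"
  proof (intro sum.cong refl)
    fix b T assume T: "T \<in> triangles n b"
    have "(\<Sum>i<n. extend_triangle n a T (i, Suc i)) = (\<Sum>i<n. b i)"
      using T by (intro sum.cong) (auto simp: extend_triangle_def triangles_def)
    moreover have "upper_size n (\<lambda>(i, j). extend_triangle n a T (i, Suc j)) = upper_size n T"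
      by (rule upper_size_cong) (auto simp: extend_triangle_def)
    ultimately show "u ^ upper_size (Suc n) (extend_triangle n a T) =
        u ^ (\<Sum>i<n. b i) * u ^ upper_size n T"
      by (simp add: upper_size_Suc power_add)
  qed
  finally have W: "(\<Sum>T\<in>triangles (Suc n) a. u ^ upper_size (Suc n) T) =
      (\<Sum>b\<in>B. u ^ (\<Sum>i<n. b i) * (\<Sum>T\<in>triangles n b. u ^ upper_size n T))"
    by (simp add: sum_distrib_left)
  \<comment> \<open>Only the zero sequence interlaces with zero, so the denominator alternant
    changes by the factor \<open>K\<close> alone.\<close>
  have "alternant u (Suc n) (\<lambda>_. 0) =
      K * (\<Sum>b\<in>{\<lambda>i\<in>{0..<n}. 0}. u ^ (\<Sum>i<n. b i) * alternant u n b)"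
    by (subst alternant_interlacing) (auto simp: K_def PiE_singleton)
  also have "\<dots> = K * alternant u n (\<lambda>_. 0)"
    using alternant_cong[of n "\<lambda>i\<in>{0..<n}. 0" "\<lambda>_. 0" u] by simp
  finally have zero: "alternant u (Suc n) (\<lambda>_. 0) = K * alternant u n (\<lambda>_. 0)" .
  have "(\<Sum>T\<in>triangles (Suc n) a. u ^ upper_size (Suc n) T) * alternant u (Suc n) (\<lambda>_. 0) =
      K * (\<Sum>b\<in>B. u ^ (\<Sum>i<n. b i) *
        ((\<Sum>T\<in>triangles n b. u ^ upper_size n T) * alternant u n (\<lambda>_. 0)))"
  proof -
    have "(\<Sum>b\<in>B. f b * g b) * (K * z) = K * (\<Sum>b\<in>B. f b * (g b * z))" for f g z
      by (simp add: sum_distrib_left sum_distrib_right mult_ac)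
    thus ?thesis
      unfolding W zero .
  qed
  also have "(\<Sum>b\<in>B. u ^ (\<Sum>i<n. b i) *
        ((\<Sum>T\<in>triangles n b. u ^ upper_size n T) * alternant u n (\<lambda>_. 0))) =
      (\<Sum>b\<in>B. u ^ (\<Sum>i<n. b i) * alternant u n b)"
    by (rule sum.cong[OF refl]) (subst Suc.IH, erule (1) mono, rule refl)
  also have "K * \<dots> = alternant u (Suc n) a"
    unfolding K_def B_def using Suc.prems by (intro alternant_interlacing[symmetric]) auto
  finally show ?case .
qed

section \<open>Vertical strips\<close>

text \<open>The dual Pieri rule. Raising the part of row i by one multiplies the entry in column j
  by \<open>u ^ j * t\<close>, a factor independent of the row, so the sum over independent choices
  factors out of the columns.\<close>

lemma sum_alternant_vertical_strips:
  fixes u t :: "'a :: comm_ring_1"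
  shows "(\<Sum>a\<in>PiE {0..<n} (\<lambda>i. {\<mu> i, Suc (\<mu> i)}). t ^ (\<Sum>i<n. a i) * alternant u n a) =
    (\<Prod>j<n. 1 + u ^ j * t) * t ^ (\<Sum>i<n. \<mu> i) * alternant u n \<mu>"
proof -
  have row: "t ^ (\<Sum>i<n. a i) * alternant u n a =
      det (mat n n (\<lambda>(i, j). t ^ a i * u ^ ((a i + (n - 1 - i)) * j)))" for a
    unfolding alternant_def by (subst det_mult_rows) (simp add: power_sum)
  have "(\<Sum>a\<in>PiE {0..<n} (\<lambda>i. {\<mu> i, Suc (\<mu> i)}). t ^ (\<Sum>i<n. a i) * alternant u n a) =
      det (mat n n (\<lambda>(i, j). \<Sum>x\<in>{\<mu> i, Suc (\<mu> i)}. t ^ x * u ^ ((x + (n - 1 - i)) * j)))"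
    unfolding row by (rule det_sum_rows[symmetric]) simp
  also have "\<dots> = det (mat n n (\<lambda>(i, j).
      t ^ \<mu> i * u ^ ((\<mu> i + (n - 1 - i)) * j) * (1 + u ^ j * t)))"
    by (intro arg_cong[of _ _ det] eq_matI) (auto simp: power_add algebra_simps)
  also have "\<dots> = (\<Prod>j<n. 1 + u ^ j * t) * (t ^ (\<Sum>i<n. \<mu> i) * alternant u n \<mu>)"
    unfolding row by (rule det_mult_columns)
  finally show ?thesis
    by (simp only: mult.assoc)
qed

text \<open>An ascent by one is cancelled by the descent of the staircase \<open>n - 1 - i\<close>,
  so two rows coincide.\<close>

lemma alternant_eq_0:
  assumes "Suc i < n" "a (Suc i) = Suc (a i)"
  shows "alternant u n a = 0"
proof -
  have "n - 1 - i = Suc (n - 1 - Suc i)"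
    using assms by simp
  hence "a (Suc i) + (n - 1 - Suc i) = a i + (n - 1 - i)"
    using assms by simp
  thus ?thesis
    unfolding alternant_def using assms(1)
    by (intro det_identical_rows[of _ n i "Suc i"]) (auto intro!: eq_vecI)
qed

subsection \<open>Vandermonde products of quantum integers\<close>

lemma qnum_diff:
  fixes u :: "'a :: field"
  assumes "u \<noteq> 1" "k \<le> l"
  shows "u ^ k - u ^ l = u ^ k * (1 - u) * qnum u (l - k)"
proof -
  have "(1 - u) * qnum u (l - k) = 1 - u ^ (l - k)"
    using assms(1) by (simp add: qnum_def)
  hence "u ^ k * (1 - u) * qnum u (l - k) = u ^ k * (1 - u ^ (l - k))"
    by (simp only: mult.assoc)
  thus ?thesis
    using assms(2) by (simp add: right_diff_distrib flip: power_add)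
qed

lemma alternant_qnum:
  fixes u :: "'a :: field"
  assumes "u \<noteq> 1"
    and "\<And>i j. i < j \<Longrightarrow> j < n \<Longrightarrow> a j \<le> a i"
  shows "alternant u n a = (\<Prod>j<n. (u ^ (a j + (n - 1 - j)) * (1 - u)) ^ j) *
    (\<Prod>j<n. \<Prod>i<j. qnum u ((a i + (n - 1 - i)) - (a j + (n - 1 - j))))"
proof -
  define l where "l i = a i + (n - 1 - i)" for i
  have le: "l j \<le> l i" if "i < j" "j < n" for i j
    using assms(2)[OF that] that by (simp add: l_def)
  have "alternant u n a = det (mat n n (\<lambda>(i, j). (u ^ l i) ^ j))"
    by (simp add: alternant_def l_def power_mult)
  also have "\<dots> = (\<Prod>j<n. \<Prod>i<j. u ^ l j - u ^ l i)"
    by (rule det_vandermonde)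
  also have "\<dots> = (\<Prod>j<n. \<Prod>i<j. u ^ l j * (1 - u) * qnum u (l i - l j))"
    by (intro prod.cong refl qnum_diff assms(1) le) auto
  finally show ?thesis
    by (simp add: prod.distrib l_def)
qed

text \<open>The principal specialization of a Schur polynomial, without division. The power of u
  arises because part j supplies the smaller exponent in exactly j of the Vandermonde
  differences.\<close>

lemma alternant_ratio:
  fixes u :: "'a :: field"
  assumes "u \<noteq> 1"
    and "\<And>i j. i < j \<Longrightarrow> j < n \<Longrightarrow> a j \<le> a i"
  shows "alternant u n a * (\<Prod>j<n. \<Prod>i<j. qnum u (j - i)) = alternant u n (\<lambda>_. 0) *
    u ^ (\<Sum>j<n. j * a j) * (\<Prod>j<n. \<Prod>i<j. qnum u ((a i + (n - 1 - i)) - (a j + (n - 1 - j))))"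
proof -
  have "(\<Prod>j<n. \<Prod>i<j. qnum u ((0 + (n - 1 - i)) - (0 + (n - 1 - j)))) =
      (\<Prod>j<n. \<Prod>i<j. qnum u (j - i))"
    by (intro prod.cong refl arg_cong[of _ _ "qnum u"]) auto
  moreover have "(\<Prod>j<n. (u ^ (a j + (n - 1 - j)) * (1 - u)) ^ j) =
      (\<Prod>j<n. (u ^ (0 + (n - 1 - j)) * (1 - u)) ^ j) * u ^ (\<Sum>j<n. j * a j)"
  proof -
    have "(u ^ (a j + k) * (1 - u)) ^ j = (u ^ (0 + k) * (1 - u)) ^ j * u ^ (a j * j)" for k j
      by (simp only: power_add power_mult power_mult_distrib add_0) (simp only: mult_ac)
    thus ?thesis
      by (simp only: prod.distrib power_sum mult.commute[of _ "a _"])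
  qed
  ultimately show ?thesis
    using alternant_qnum[of u n a, OF assms] alternant_qnum[of u n "\<lambda>_. 0", OF assms(1)]
    by (simp only: mult_ac)
qed

section \<open>Vandermonde products over sets\<close>

text \<open>The q-integer of |x - y|; \<open>max\<close> and \<open>min\<close> keep the subtraction
  from truncating in either order.\<close>

definition qdist :: "'a :: field \<Rightarrow> nat \<Rightarrow> nat \<Rightarrow> 'a" where
  "qdist u x y = qnum u (max x y - min x y)"

lemma qdist_commute: "qdist u x y = qdist u y x"
  by (simp add: qdist_def max.commute min.commute)

lemma qdist_less: "x < y \<Longrightarrow> qdist u x y = qnum u (y - x)"
  by (simp add: qdist_def)

text \<open>Indexed by a set rather than a sequence, so that a set can be exchanged for its
  complement.\<close>

definition qvandermonde :: "'a :: field \<Rightarrow> nat set \<Rightarrow> 'a" where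
  "qvandermonde u A = (\<Prod>y\<in>A. \<Prod>x\<in>{x \<in> A. x < y}. qdist u x y)"

lemma qvandermonde_insert:
  assumes "finite A" "c \<notin> A"
  shows "qvandermonde u (insert c A) = qvandermonde u A * (\<Prod>x\<in>A. qdist u x c)"
proof -
  have split: "(\<Prod>x\<in>{x \<in> insert c A. x < y}. qdist u x y) =
      (if c < y then qdist u y c else 1) * (\<Prod>x\<in>{x \<in> A. x < y}. qdist u x y)" for y
  proof (cases "c < y")
    case True
    hence "{x \<in> insert c A. x < y} = insert c {x \<in> A. x < y}"
      by auto
    thus ?thesis
      using True assms qdist_commute[of u c y] by simp
  next
    case False
    hence "{x \<in> insert c A. x < y} = {x \<in> A. x < y}"
      by auto
    thus ?thesis
      using False by simp
  qed
  have "(\<Prod>x\<in>{x \<in> A. x < c}. qdist u x c) = (\<Prod>x\<in>A. if x < c then qdist u x c else 1)"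
    using assms by (simp add: prod.inter_filter)
  moreover have "(\<Prod>x\<in>A. qdist u x c) =
      (\<Prod>x\<in>A. (if x < c then qdist u x c else 1) * (if c < x then qdist u x c else 1))"
    using assms by (intro prod.cong) auto
  ultimately show ?thesis
    unfolding qvandermonde_def split using assms by (simp add: prod.distrib mult_ac)
qed

text \<open>The enumeration \<open>f\<close> may reverse the order, as the shifted levels do; the
  symmetry of \<open>qdist\<close> makes this harmless.\<close>

lemma qvandermonde_image:
  fixes I :: "nat set"
  assumes "finite I" "inj_on f I"
  shows "qvandermonde u (f ` I) = (\<Prod>j\<in>I. \<Prod>i\<in>{i \<in> I. i < j}. qdist u (f i) (f j))"
  using assms
proof (induction I rule: finite_linorder_max_induct)
  case (insert b I)
  have "f b \<notin> f ` I"
    using insert by (auto simp: inj_on_def)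
  hence "qvandermonde u (f ` insert b I) = qvandermonde u (f ` I) * (\<Prod>x\<in>f ` I. qdist u x (f b))"
    using insert.hyps by (simp add: qvandermonde_insert)
  also have "(\<Prod>x\<in>f ` I. qdist u x (f b)) = (\<Prod>i\<in>I. qdist u (f i) (f b))"
    using insert.prems by (subst prod.reindex) (auto simp: inj_on_def)
  finally have "qvandermonde u (f ` insert b I) =
      (\<Prod>j\<in>I. \<Prod>i\<in>{i \<in> I. i < j}. qdist u (f i) (f j)) * (\<Prod>i\<in>I. qdist u (f i) (f b))"
    using insert by simp
  moreover have "{i \<in> insert b I. i < b} = I"
    using insert.hyps by auto
  moreover have "{i \<in> insert b I. i < j} = {i \<in> I. i < j}" if "j \<in> I" for j
    using insert.hyps that by auto
  moreover have "b \<notin> I"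
    using insert.hyps by auto
  ultimately show ?case
    using insert.hyps by (simp add: mult.commute)
qed (simp add: qvandermonde_def)

text \<open>Both sides count the pairs inside \<open>A\<close> and the mixed pairs once and the pairs inside \<open>C\<close> twice.\<close>

lemma qvandermonde_complement:
  assumes "finite A" "finite C" "A \<inter> C = {}"
  shows "qvandermonde u A * (\<Prod>c\<in>C. \<Prod>x\<in>(A \<union> C) - {c}. qdist u x c) =
    qvandermonde u (A \<union> C) * qvandermonde u C"
  using assms(2,3)
proof (induction C rule: finite_induct)
  case empty
  show ?case by (simp add: qvandermonde_def)
next
  case (insert d C)
  have "d \<notin> A \<union> C"
    using insert by auto
  have "(\<Prod>x\<in>(A \<union> insert d C) - {c}. qdist u x c) =
      qdist u c d * (\<Prod>x\<in>(A \<union> C) - {c}. qdist u x c)" if "c \<in> C" for c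
  proof -
    have "(A \<union> insert d C) - {c} = insert d ((A \<union> C) - {c})"
      using insert that by auto
    thus ?thesis
      using \<open>d \<notin> A \<union> C\<close> assms(1) insert.hyps by (simp add: qdist_commute[of u d])
  qed
  moreover have "(A \<union> insert d C) - {d} = A \<union> C"
    using \<open>d \<notin> A \<union> C\<close> by auto
  ultimately have "qvandermonde u A *
      (\<Prod>c\<in>insert d C. \<Prod>x\<in>(A \<union> insert d C) - {c}. qdist u x c) =
      (qvandermonde u A * (\<Prod>c\<in>C. \<Prod>x\<in>(A \<union> C) - {c}. qdist u x c)) *
      (\<Prod>x\<in>A \<union> C. qdist u x d) * (\<Prod>c\<in>C. qdist u c d)"
    using insert.hyps by (simp add: prod.distrib mult_ac)
  also have "\<dots> = (qvandermonde u (A \<union> C) * (\<Prod>x\<in>A \<union> C. qdist u x d)) *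
      (qvandermonde u C * (\<Prod>c\<in>C. qdist u c d))"
    using insert by simp
  also have "\<dots> = qvandermonde u (A \<union> insert d C) * qvandermonde u (insert d C)"
    using \<open>d \<notin> A \<union> C\<close> assms(1) insert.hyps by (simp add: qvandermonde_insert)
  finally show ?case .
qed

lemma prod_qdist_below: "(\<Prod>x<c. qdist u x c) = qfact u c"
proof -
  have "(\<Prod>x<c. qdist u x c) = (\<Prod>x<c. qnum u (c - x))"
    by (intro prod.cong) (auto simp: qdist_less)
  also have "\<dots> = qfact u c"
    unfolding qfact_def by (rule prod.reindex_bij_witness[of _ "\<lambda>i. c - i" "\<lambda>x. c - x"]) auto
  finally show ?thesis .
qed

text \<open>The numbers below \<open>c\<close> give one q-factorial and those above give the other;
  this is the source of the pair of factorials in the denominator of the theorem.\<close>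

lemma prod_qdist_lessThan:
  assumes "c < k"
  shows "(\<Prod>x\<in>{..<k} - {c}. qdist u x c) = qfact u c * qfact u (k - 1 - c)"
proof -
  have "{..<k} - {c} = {..<c} \<union> {c<..<k}"
    using assms by auto
  moreover have "{..<c} \<inter> {c<..<k} = {}"
    by auto
  ultimately have "(\<Prod>x\<in>{..<k} - {c}. qdist u x c) =
      qfact u c * (\<Prod>x\<in>{c<..<k}. qdist u x c)"
    by (simp add: prod.union_disjoint prod_qdist_below)
  also have "(\<Prod>x\<in>{c<..<k}. qdist u x c) = (\<Prod>x\<in>{c<..<k}. qnum u (x - c))"
    by (intro prod.cong) (auto simp: qdist_def)
  also have "\<dots> = qfact u (k - 1 - c)"
    unfolding qfact_def
    by (rule prod.reindex_bij_witness[of _ "\<lambda>i. i + c" "\<lambda>x. x - c"]) auto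
  finally show ?thesis .
qed

lemma qvandermonde_lessThan: "qvandermonde u {..<k} = (\<Prod>i<k. qfact u i)"
proof (induction k)
  case (Suc k)
  show ?case
    by (simp add: lessThan_Suc qvandermonde_insert prod_qdist_below Suc.IH mult.commute)
qed (simp add: qvandermonde_def)

subsection \<open>The minimal diagonal\<close>

text \<open>The least value that block symmetry allows on the diagonal, with rows indexed from \<open>0\<close>.\<close>

definition level :: "(nat \<Rightarrow> nat) \<Rightarrow> nat \<Rightarrow> nat \<Rightarrow> nat" where
  "level S n i = card {k \<in> {1..n}. i < S n - S k}"

text \<open>By monotonicity of \<open>S\<close>, the indices counted by \<open>level\<close> for a
  row of block k are exactly 1, ..., k - 1.\<close>

lemma level_block:
  assumes "mono S" "k \<in> {1..n}" "S n - S k \<le> i" "i < S n - S (k - 1)"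
  shows "level S n i = k - 1"
proof -
  have iff: "i < S n - S k' \<longleftrightarrow> k' \<le> k - 1" for k'
  proof
    assume "i < S n - S k'"
    hence "\<not> S k \<le> S k'"
      using assms(3) by auto
    hence "\<not> k \<le> k'"
      using monoD[OF assms(1), of k k'] by auto
    thus "k' \<le> k - 1" by simp
  next
    assume "k' \<le> k - 1"
    thus "i < S n - S k'"
      using assms(4) monoD[OF assms(1), of k' "k - 1"] by simp
  qed
  have "{k' \<in> {1..n}. i < S n - S k'} = {1..k - 1}"
    unfolding iff using assms(2) by auto
  thus ?thesis
    by (simp add: level_def)
qed

lemma block_exists:
  fixes S :: "nat \<Rightarrow> nat" and n :: nat
  assumes "S 0 = 0" "i < S n"
  obtains k where "k \<in> {1..n}" "S n - S k \<le> i" "i < S n - S (k - 1)"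
proof -
  define k where "k = (LEAST k. S n - S k \<le> i)"
  have "S n - S k \<le> i"
    unfolding k_def by (rule LeastI[of _ n]) simp
  moreover have "k \<le> n"
    unfolding k_def by (rule Least_le) simp
  moreover have "k \<noteq> 0"
    using \<open>S n - S k \<le> i\<close> assms by (intro notI) simp
  moreover have "\<not> S n - S (k - 1) \<le> i"
    using not_less_Least[of "k - 1" "\<lambda>k. S n - S k \<le> i"] \<open>k \<noteq> 0\<close> by (simp add: k_def)
  ultimately show ?thesis
    by (intro that[of k]) auto
qed

lemma level_antimono: "i \<le> j \<Longrightarrow> level S n j \<le> level S n i"
  unfolding level_def by (intro card_mono) auto

text \<open>The index k = n is never counted, since \<open>S n - S n = 0\<close>. This strictness
  leaves room for the possible increment of a diagonal entry.\<close>

lemma level_less: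
  assumes "n \<ge> 1"
  shows "level S n i < n"
proof -
  have "level S n i \<le> card {1..<n}"
    unfolding level_def
  proof (intro card_mono subsetI)
    fix k assume "k \<in> {k \<in> {1..n}. i < S n - S k}"
    thus "k \<in> {1..<n}"
      by (cases "k = n") auto
  qed simp
  thus ?thesis
    using assms by simp
qed

text \<open>Double counting of the cells of a Young diagram, by rows and by columns of length
  \<open>S n - S k\<close>. The weight 1 gives \<beta>, and the weight i gives \<alpha>.\<close>

lemma sum_level_weighted:
  "(\<Sum>i<S n. f i * level S n i) = (\<Sum>k = 1..n. \<Sum>i<S n - S k. f i)"
proof -
  have "f i * level S n i = (\<Sum>k = 1..n. if i < S n - S k then f i else 0)" for i
  proof -
    have "f i * level S n i = (\<Sum>k\<in>{k \<in> {1..n}. i < S n - S k}. f i)"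
      by (simp add: level_def)
    thus ?thesis
      by (simp only: sum.inter_filter[OF finite_atLeastAtMost])
  qed
  hence "(\<Sum>i<S n. f i * level S n i) =
      (\<Sum>i<S n. \<Sum>k = 1..n. if i < S n - S k then f i else 0)"
    by (intro sum.cong refl)
  also have "\<dots> = (\<Sum>k = 1..n. \<Sum>i<S n. if i < S n - S k then f i else 0)"
    by (rule sum.swap)
  also have "\<dots> = (\<Sum>k = 1..n. \<Sum>i<S n - S k. f i)"
  proof (rule sum.cong[OF refl])
    fix k
    have "{i \<in> {..<S n}. i < S n - S k} = {..<S n - S k}"
      by auto
    thus "(\<Sum>i<S n. if i < S n - S k then f i else 0) = (\<Sum>i<S n - S k. f i)"
      by (subst sum.inter_filter[symmetric]) simp_all
  qed
  finally show ?thesis .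
qed

text \<open>The positions of the unit steps in one direction along the boundary path of the partition
  \<open>level S n\<close> are the shifted parts, those in the other direction are the numbers \<open>S k + k - 1\<close>.\<close>

lemma shifted_levels_complement:
  fixes n :: nat
  assumes "mono S" "S 0 = 0"
  defines "l \<equiv> \<lambda>i. level S n i + (S n - 1 - i)"
    and "c \<equiv> \<lambda>k. S k + k - 1"
  shows "inj_on l {..<S n}" "inj_on c {1..n}"
    and "l ` {..<S n} \<inter> c ` {1..n} = {}" "l ` {..<S n} \<union> c ` {1..n} = {..<S n + n}"
proof -
  have l_less: "l j < l i" if "i < j" "j < S n" for i j
    using level_antimono[of i j S n] that by (simp add: l_def)
  have c_less: "c i < c j" if "i < j" "1 \<le> i" for i j
    using monoD[OF assms(1), of i j] that by (simp add: c_def)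
  show inj_l: "inj_on l {..<S n}"
    by (intro linorder_inj_onI' less_imp_neq[symmetric] l_less) simp_all
  show inj_c: "inj_on c {1..n}"
    by (intro linorder_inj_onI' less_imp_neq c_less) simp_all
  \<comment> \<open>A row i of block k satisfies c (k - 1) < l i < c k (the left part when k > 1),
    so \<open>l i\<close> falls strictly between consecutive values of \<open>c\<close>.\<close>
  have block: "\<exists>k\<in>{1..n}. l i < c k \<and> (\<forall>k'\<in>{1..n}. k' < k \<longrightarrow> c k' < l i)" if i: "i < S n" for i
  proof -
    obtain k where k: "k \<in> {1..n}" "S n - S k \<le> i" "i < S n - S (k - 1)"
      using assms(2) i by (rule block_exists)
    have l: "l i = k - 1 + (S n - 1 - i)"
      using level_block[OF assms(1) k] by (simp add: l_def)
    have "S k \<le> S n"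
      using monoD[OF assms(1), of k n] k(1) by simp
    hence "l i < c k"
      using k i by (auto simp: l c_def)
    moreover have "c k' < l i" if "k' \<in> {1..n}" "k' < k" for k'
    proof -
      have "S k' \<le> S (k - 1)"
        using that(2) by (intro monoD[OF assms(1)]) simp
      thus ?thesis
        using that k by (auto simp: l c_def)
    qed
    ultimately show ?thesis
      using k(1) by blast
  qed
  show disjoint: "l ` {..<S n} \<inter> c ` {1..n} = {}"
  proof (rule equals0I)
    fix x assume "x \<in> l ` {..<S n} \<inter> c ` {1..n}"
    then obtain i k' where i: "i < S n" "x = l i" and k': "k' \<in> {1..n}" "x = c k'"
      by auto
    obtain k where k: "k \<in> {1..n}" "l i < c k" "\<forall>k'\<in>{1..n}. k' < k \<longrightarrow> c k' < l i"
      using block[OF i(1)] by blast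
    have "k \<le> k'"
    proof (rule ccontr)
      assume "\<not> k \<le> k'"
      hence "c k' < l i"
        using k(3) k'(1) by simp
      thus False
        using i(2) k'(2) by simp
    qed
    hence "c k \<le> c k'"
      using c_less[of k k'] k(1) by (cases "k = k'") auto
    thus False
      using k(2) i(2) k'(2) by simp
  qed
  have c_bound: "c k < S n + n" if "k \<in> {1..n}" for k
    using monoD[OF assms(1), of k n] that by (auto simp: c_def)
  have sub: "l ` {..<S n} \<union> c ` {1..n} \<subseteq> {..<S n + n}"
  proof (intro Un_least image_subsetI)
    fix i assume "i \<in> {..<S n}"
    then obtain k where "k \<in> {1..n}" "l i < c k"
      using block by blast
    thus "l i \<in> {..<S n + n}"
      using c_bound[of k] by simp
  qed (use c_bound in simp)
  \<comment> \<open>Disjointness and injectivity give S n + n distinct numbers below S n + n, hence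
    all of them.\<close>
  moreover have "card (l ` {..<S n} \<union> c ` {1..n}) = card {..<S n + n}"
    using disjoint card_image[OF inj_l] card_image[OF inj_c] by (simp add: card_Un_disjoint)
  ultimately show "l ` {..<S n} \<union> c ` {1..n} = {..<S n + n}"
    by (rule card_subset_eq[OF finite_lessThan])
qed

lemma qnum_nonzero: "u ^ k \<noteq> 1 \<Longrightarrow> qnum u k \<noteq> 0"
  by (cases "u = 1") (auto simp: qnum_def)

text \<open>With L the shifted parts and C their complement, the Vandermonde product of L is that of
  the full interval times that of C, divided by the factorials attached to C. Since u is not a root
  of unity, all these q-integers are nonzero.\<close>

theorem alternant_level:
  fixes u :: "'a :: field"
  assumes "mono S" "S 0 = 0"
    and u: "u \<noteq> 0" "\<And>k. k > 0 \<Longrightarrow> u ^ k \<noteq> 1"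
  shows "alternant u (S n) (level S n) = alternant u (S n) (\<lambda>_. 0) *
    u ^ (\<Sum>k = 1..n. (S n - S k) choose 2) *
    (((\<Prod>(i, j) \<in> {(i, j). 1 \<le> i \<and> i < j \<and> j \<le> n}. qnum u (S j - S i + (j - i))) *
      (\<Prod>i = 1..n. qfact u (S n + i - 1))) /
     (\<Prod>i = 1..n. qfact u (S i + i - 1) * qfact u (S n - S i + (n - i))))"
proof -
  define l where "l i = level S n i + (S n - 1 - i)" for i
  define c where "c k = S k + k - 1" for k
  define L where "L = l ` {..<S n}"
  define C where "C = c ` {1..n}"
  define D where
    "D = (\<Prod>k = 1..n. qfact u (S k + k - 1) * qfact u (S n - S k + (n - k)))"
  note compl = shifted_levels_complement[OF assms(1,2), of n, folded l_def c_def, folded L_def C_def]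
  have [simp]: "qnum u k \<noteq> 0" if "k > 0" for k
    using qnum_nonzero u(2)[OF that] by blast
  have [simp]: "qfact u k \<noteq> 0" for k
    by (simp add: qfact_def)
  have "u \<noteq> 1"
    using u(2)[of 1] by simp
  have l_less: "l j < l i" if "i < j" "j < S n" for i j
    using level_antimono[of i j S n] that by (simp add: l_def)

  have qdist_l: "qdist u (l i) (l j) = qnum u (l i - l j)" if "i < j" "j < S n" for i j
    using l_less[OF that] by (simp add: qdist_def)
  have "qvandermonde u L = (\<Prod>j<S n. \<Prod>i\<in>{i \<in> {..<S n}. i < j}. qdist u (l i) (l j))"
    unfolding L_def by (rule qvandermonde_image) (use compl in auto)
  also have "\<dots> = (\<Prod>j<S n. \<Prod>i<j. qnum u (l i - l j))"
    by (intro prod.cong) (auto simp: qdist_l)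
  finally have "alternant u (S n) (level S n) * (\<Prod>j<S n. \<Prod>i<j. qnum u (j - i)) =
      alternant u (S n) (\<lambda>_. 0) * u ^ (\<Sum>j<S n. j * level S n j) * qvandermonde u L"
    using alternant_ratio[OF \<open>u \<noteq> 1\<close>, of "S n" "level S n"]
    by (simp add: l_def level_antimono)
  also have "(\<Prod>j<S n. \<Prod>i<j. qnum u (j - i)) = (\<Prod>j<S n. \<Prod>i<j. qdist u i j)"
    by (intro prod.cong refl) (auto simp: qdist_less)
  also have "\<dots> = (\<Prod>j<S n. qfact u j)"
    by (simp add: prod_qdist_below)
  also have "(\<Sum>j<S n. j * level S n j) = (\<Sum>k = 1..n. (S n - S k) choose 2)"
    by (subst sum_level_weighted)
       (simp add: choose_two lessThan_atLeast0 Sum_Ico_nat)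
  finally have ratio: "alternant u (S n) (level S n) * (\<Prod>j<S n. qfact u j) =
      alternant u (S n) (\<lambda>_. 0) * u ^ (\<Sum>k = 1..n. (S n - S k) choose 2) * qvandermonde u L" .

  have "(\<Prod>d\<in>C. \<Prod>x\<in>{..<S n + n} - {d}. qdist u x d) =
      (\<Prod>d\<in>C. qfact u d * qfact u (S n + n - 1 - d))"
    using compl(4) by (intro prod.cong refl prod_qdist_lessThan) auto
  also have "\<dots> = (\<Prod>k = 1..n. qfact u (c k) * qfact u (S n + n - 1 - c k))"
    unfolding C_def by (subst prod.reindex) (use compl in auto)
  also have "\<dots> = (\<Prod>k = 1..n. qfact u (S k + k - 1) * qfact u (S n - S k + (n - k)))"
  proof (intro prod.cong refl arg_cong2[of _ _ _ _ "(*)"] arg_cong[of _ _ "qfact u"])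
    show "c k = S k + k - 1" for k
      by (simp add: c_def)
    show "S n + n - 1 - c k = S n - S k + (n - k)" if "k \<in> {1..n}" for k
      using monoD[OF assms(1), of k n] that by (simp add: c_def)
  qed
  finally have denom: "(\<Prod>d\<in>C. \<Prod>x\<in>{..<S n + n} - {d}. qdist u x d) =
      (\<Prod>k = 1..n. qfact u (S k + k - 1) * qfact u (S n - S k + (n - k)))" .

  have "qvandermonde u C = (\<Prod>j\<in>{1..n}. \<Prod>i\<in>{i \<in> {1..n}. i < j}. qdist u (c i) (c j))"
    unfolding C_def by (rule qvandermonde_image) (use compl in auto)
  also have "\<dots> = (\<Prod>(j, i)\<in>(SIGMA j : {1..n}. {i \<in> {1..n}. i < j}). qdist u (c i) (c j))"
    by (rule prod.Sigma) auto
  also have "\<dots> = (\<Prod>(i, j) \<in> {(i, j). 1 \<le> i \<and> i < j \<and> j \<le> n}. qnum u (S j - S i + (j - i)))"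
  proof (rule prod.reindex_bij_witness[of _ prod.swap prod.swap])
    fix p assume p: "p \<in> (SIGMA j : {1..n}. {i \<in> {1..n}. i < j})"
    obtain j i where [simp]: "p = (j, i)" by (cases p)
    have "c i < c j" "c j - c i = S j - S i + (j - i)"
      using monoD[OF assms(1), of i j] p by (auto simp: c_def)
    thus "(case prod.swap p of (i, j) \<Rightarrow> qnum u (S j - S i + (j - i))) =
        (case p of (j, i) \<Rightarrow> qdist u (c i) (c j))"
      by (simp add: qdist_less)
  qed auto
  finally have numer: "qvandermonde u C =
      (\<Prod>(i, j) \<in> {(i, j). 1 \<le> i \<and> i < j \<and> j \<le> n}. qnum u (S j - S i + (j - i)))" .

  \<comment> \<open>The part below \<open>S n\<close> is split off because it cancels the
    q-factorials contributed by the zero alternant.\<close>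
  have "{..<S n + n} = {..<S n} \<union> {S n..<S n + n}"
    by auto
  hence "(\<Prod>i<S n + n. qfact u i) = (\<Prod>i<S n. qfact u i) * (\<Prod>i = S n..<S n + n. qfact u i)"
    by (simp add: prod.union_disjoint ivl_disj_int)
  also have "(\<Prod>i = S n..<S n + n. qfact u i) = (\<Prod>i = 1..n. qfact u (S n + i - 1))"
    by (rule prod.reindex_bij_witness[of _ "\<lambda>i. S n + i - 1" "\<lambda>i. i + 1 - S n"]) auto
  finally have total: "qvandermonde u {..<S n + n} =
      (\<Prod>i<S n. qfact u i) * (\<Prod>i = 1..n. qfact u (S n + i - 1))"
    by (simp add: qvandermonde_lessThan)

  have "qvandermonde u L * (\<Prod>d\<in>C. \<Prod>x\<in>{..<S n + n} - {d}. qdist u x d) =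
      qvandermonde u {..<S n + n} * qvandermonde u C"
    using qvandermonde_complement[of L C u] compl(3,4) by (simp add: L_def C_def)
  hence "qvandermonde u L * D = (\<Prod>i<S n. qfact u i) *
      (\<Prod>i = 1..n. qfact u (S n + i - 1)) * qvandermonde u C"
    unfolding denom total D_def .
  moreover have "D \<noteq> 0"
    by (simp add: D_def)
  ultimately have "qvandermonde u L = (\<Prod>i<S n. qfact u i) *
      (\<Prod>i = 1..n. qfact u (S n + i - 1)) * qvandermonde u C / D"
    by (rule eq_divide_imp[rotated])
  hence "alternant u (S n) (level S n) * (\<Prod>j<S n. qfact u j) =
      (alternant u (S n) (\<lambda>_. 0) * u ^ (\<Sum>k = 1..n. (S n - S k) choose 2) *
      (qvandermonde u C * (\<Prod>i = 1..n. qfact u (S n + i - 1)) / D)) * (\<Prod>j<S n. qfact u j)"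
    unfolding ratio by (simp only: mult_ac times_divide_eq_right times_divide_eq_left)
  moreover have "(\<Prod>j<S n. qfact u j) \<noteq> 0"
    by simp
  ultimately show ?thesis
    unfolding numer D_def by (rule mult_right_cancel[THEN iffD1, rotated])
qed

lemma alternant_zero_nonzero:
  fixes u :: "'a :: field"
  assumes "u \<noteq> 0" "\<And>k. k > 0 \<Longrightarrow> u ^ k \<noteq> 1"
  shows "alternant u n (\<lambda>_. 0) \<noteq> 0"
proof -
  have "qnum u k \<noteq> 0" if "k > 0" for k
    using qnum_nonzero assms(2)[OF that] by blast
  moreover have "u \<noteq> 1"
    using assms(2)[of 1] by simp
  ultimately show ?thesis
    using assms(1) by (subst alternant_qnum) auto
qed

subsection \<open>Block symmetric plane partitions\<close>

lemma mono_psum: "mono (psum r)"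
  unfolding psum_def by (intro monoI sum_mono2) auto

text \<open>The blocks partition the rows, and \<open>level\<close> is k - 1 on block k, so the
  condition per block becomes one per row. \<open>Suc i\<close> reconciles rows counted from 1 with
  levels counted from 0.\<close>

lemma block_symmetric_iff_level:
  "block_symmetric n (psum r n) r \<pi> \<longleftrightarrow>
    (\<forall>i\<in>{1..psum r n}. \<forall>j\<in>{1..psum r n}. \<pi> (i, j) = \<pi> (j, i)) \<and>
    (\<forall>i<psum r n. \<pi> (Suc i, Suc i) \<in> {level (psum r) n i, Suc (level (psum r) n i)})"
    (is "_ \<longleftrightarrow> _ \<and> ?levels")
proof -
  define S where "S = psum r"
  have S: "mono S" "S 0 = 0"
    by (simp_all add: S_def mono_psum psum_def)
  have "?levels \<longleftrightarrow> (\<forall>k\<in>{1..n}. \<forall>i\<in>{1..S n - S (k - 1)} - {1..S n - S k}.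
      \<pi> (i, i) \<in> {k - 1, k})" (is "_ \<longleftrightarrow> ?blocks")
  proof
    assume levels: ?levels
    show ?blocks
    proof (intro ballI)
      fix k i assume k: "k \<in> {1..n}" and i: "i \<in> {1..S n - S (k - 1)} - {1..S n - S k}"
      have "S n - S k \<le> i - 1" "i - 1 < S n - S (k - 1)"
        using i by auto
      hence "level S n (i - 1) = k - 1"
        by (rule level_block[OF S(1) k])
      moreover have "Suc (i - 1) = i" "i - 1 < S n"
        using i by auto
      ultimately show "\<pi> (i, i) \<in> {k - 1, k}"
        using levels[rule_format, of "i - 1"] k by (auto simp: S_def)
    qed
  next
    assume blocks: ?blocks
    show ?levels
    proof (intro allI impI)
      fix i assume "i < psum r n"
      then obtain k where k: "k \<in> {1..n}" "S n - S k \<le> i" "i < S n - S (k - 1)"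
        using block_exists[of S i n thesis] S(2) by (auto simp: S_def)
      have "Suc i \<in> {1..S n - S (k - 1)} - {1..S n - S k}"
        using k by auto
      hence "\<pi> (Suc i, Suc i) \<in> {k - 1, k}"
        using blocks k(1) by blast
      thus "\<pi> (Suc i, Suc i) \<in> {level (psum r) n i, Suc (level (psum r) n i)}"
        using level_block[OF S(1) k] k(1) by (auto simp: S_def)
    qed
  qed
  thus ?thesis
    by (simp add: block_symmetric_def S_def)
qed

lemma nondiag_size_symmetric:
  assumes "\<forall>i\<in>{1..m}. \<forall>j\<in>{1..m}. \<pi> (i, j) = \<pi> (j, i)"
  shows "nondiag_size m \<pi> = 2 * upper_size m (\<lambda>(i, j). \<pi> (Suc i, Suc j))"
proof -
  define U where "U = {(i, j). 1 \<le> i \<and> i < j \<and> j \<le> m}"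
  have "finite U"
    by (rule finite_subset[of _ "{1..m} \<times> {1..m}"]) (auto simp: U_def)
  have "{(i, j). i \<in> {1..m} \<and> j \<in> {1..m} \<and> i \<noteq> j} = U \<union> prod.swap ` U"
    by (force simp: U_def image_iff)
  moreover have "U \<inter> prod.swap ` U = {}"
    by (auto simp: U_def)
  ultimately have "nondiag_size m \<pi> = (\<Sum>p\<in>U. \<pi> p) + (\<Sum>p\<in>prod.swap ` U. \<pi> p)"
    using \<open>finite U\<close> by (simp add: nondiag_size_def sum.union_disjoint)
  also have "(\<Sum>p\<in>prod.swap ` U. \<pi> p) = (\<Sum>p\<in>U. \<pi> (prod.swap p))"
    by (subst sum.reindex) (auto simp: inj_on_def)
  also have "\<dots> = (\<Sum>p\<in>U. \<pi> p)"
    using assms by (intro sum.cong) (auto simp: U_def)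
  also have "(\<Sum>p\<in>U. \<pi> p) = (\<Sum>(j, i)\<in>(SIGMA j : {..<m}. {..<j}). \<pi> (Suc i, Suc j))"
    by (rule sum.reindex_bij_witness[of _ "\<lambda>(j, i). (Suc i, Suc j)" "\<lambda>(i, j). (j - 1, i - 1)"])
       (auto simp: U_def)
  also have "\<dots> = (\<Sum>j<m. \<Sum>i<j. \<pi> (Suc i, Suc j))"
    by (rule sum.Sigma[symmetric]) auto
  finally show ?thesis
    by (simp add: upper_size_def)
qed

text \<open>Weak decrease is a genuine restriction inside a block, where the level is constant and
  independent choices could ascend.\<close>

definition diagonals :: "(nat \<Rightarrow> nat) \<Rightarrow> nat \<Rightarrow> (nat \<Rightarrow> nat) set" where
  "diagonals S n = {a \<in> PiE {0..<S n} (\<lambda>i. {level S n i, Suc (level S n i)}).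
     \<forall>i j. i \<le> j \<and> j < S n \<longrightarrow> a j \<le> a i}"

text \<open>Triangles are indexed from 0 and plane partitions from 1, whence the two
  subtractions.\<close>

definition symmetric_array :: "nat \<Rightarrow> (nat \<times> nat \<Rightarrow> nat) \<Rightarrow> nat \<times> nat \<Rightarrow> nat" where
  "symmetric_array m T = restrict (\<lambda>(i, j). T (min i j - 1, max i j - 1)) ({1..m} \<times> {1..m})"

lemma symmetric_array_Suc:
  "i < m \<Longrightarrow> j < m \<Longrightarrow> symmetric_array m T (Suc i, Suc j) = T (min i j, max i j)"
  by (auto simp: symmetric_array_def min_def max_def)

text \<open>A row of the symmetric array runs down a column of the triangle to the diagonal and then
  along a row; in the middle case the two entries are compared through the diagonal entry (i,
  i).\<close>

lemma triangles_mono: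
  assumes "T \<in> triangles m a" "i < m" "j' < m" "j \<le> j'"
  shows "T (min i j', max i j') \<le> T (min i j, max i j)"
proof -
  have row: "T (i, j') \<le> T (i, j)" if "i \<le> j" "j \<le> j'" "j' < m" for i j j'
    using assms(1) that unfolding triangles_def by blast
  have col: "T (i', j) \<le> T (i, j)" if "i \<le> i'" "i' \<le> j" "j < m" for i i' j
    using assms(1) that unfolding triangles_def by blast
  consider "i \<le> j" | "j \<le> i" "i \<le> j'" | "j' \<le> i"
    by linarith
  thus ?thesis
  proof cases
    case 1
    thus ?thesis
      using assms row[of i j j'] by simp
  next
    case 2
    thus ?thesis
      using assms row[of i i j'] col[of j i i] by simp
  next
    case 3
    thus ?thesis
      using assms col[of j j' i] by simp
  qed
qed

lemma symmetric_array_block_symmetric: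
  assumes "n \<ge> 1" "a \<in> diagonals (psum r) n" "T \<in> triangles (psum r n) a"
  shows "symmetric_array (psum r n) T \<in> block_symmetric_pps n (psum r n) r"
proof -
  let ?m = "psum r n" and ?\<pi> = "symmetric_array (psum r n) T"
  have diag: "T (i, i) = a i" if "i < ?m" for i
    using assms(3) that by (auto simp: triangles_def)
  have level: "a i \<in> {level (psum r) n i, Suc (level (psum r) n i)}" if "i < ?m" for i
    using assms(2) that by (auto simp: diagonals_def PiE_iff)
  have sym: "?\<pi> (i, j) = ?\<pi> (j, i)" for i j
    by (auto simp: symmetric_array_def min.commute max.commute)
  have row: "?\<pi> (i, j') \<le> ?\<pi> (i, j)" if ij: "i \<in> {1..?m}" "j \<in> {1..?m}" "j' \<in> {1..?m}" "j \<le> j'" for i j j'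
  proof -
    obtain i0 j0 j0' where [simp]: "i = Suc i0" "j = Suc j0" "j' = Suc j0'"
      using ij by (cases i; cases j; cases j') auto
    show ?thesis
      using triangles_mono[OF assms(3), of i0 j0' j0] ij by (simp add: symmetric_array_Suc)
  qed
  have col: "?\<pi> (i', j) \<le> ?\<pi> (i, j)"
    if "i \<in> {1..?m}" "i' \<in> {1..?m}" "j \<in> {1..?m}" "i \<le> i'" for i i' j
    using row[of j i i'] that by (simp only: sym[of j])
  \<comment> \<open>The corner entry is the largest, and it is at most one more than a level, which
    is less than n.\<close>
  have "?\<pi> (i, j) \<le> n" if "i \<in> {1..?m}" "j \<in> {1..?m}" for i j
  proof -
    have "?\<pi> (i, j) \<le> ?\<pi> (1, j)"
      using that by (intro col) auto
    also have "?\<pi> (1, j) \<le> ?\<pi> (1, 1)"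
      using that by (intro row) auto
    also have "?\<pi> (1, 1) = a 0"
      using that diag[of 0] symmetric_array_Suc[of 0 ?m 0 T] by simp
    also have "\<dots> \<le> n"
      using level[of 0] level_less[OF assms(1), of "psum r" 0] that by auto
    finally show ?thesis .
  qed
  moreover have "?\<pi> \<in> extensional ({1..?m} \<times> {1..?m})"
    by (simp add: symmetric_array_def)
  ultimately have "?\<pi> \<in> plane_partitions n ?m"
    unfolding plane_partitions_def using row col by (auto simp: PiE_iff)
  moreover have "block_symmetric n ?m r ?\<pi>"
    unfolding block_symmetric_iff_level using sym level
    by (auto simp: symmetric_array_Suc diag)
  ultimately show ?thesis
    by (simp add: block_symmetric_pps_def)
qed

text \<open>The bijection sends an array to its diagonal and its upper triangle. Symmetry doubles
  the off-diagonal weight, which is why the triangles are counted by q^2.\<close>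

lemma sum_block_symmetric_pps:
  fixes q t :: "'a :: comm_ring_1"
  assumes "n \<ge> 1"
  shows "(\<Sum>\<pi>\<in>block_symmetric_pps n (psum r n) r.
      q ^ nondiag_size (psum r n) \<pi> * t ^ diag_size (psum r n) \<pi>) =
    (\<Sum>(a, T)\<in>(SIGMA a : diagonals (psum r) n. triangles (psum r n) a).
      t ^ (\<Sum>i<psum r n. a i) * (q\<^sup>2) ^ upper_size (psum r n) T)"
proof -
  define m where "m = psum r n"
  define diag where "diag \<pi> = restrict (\<lambda>i. \<pi> (Suc i, Suc i)) {0..<m}" for \<pi> :: "nat \<times> nat \<Rightarrow> nat"
  define upper where "upper \<pi> = restrict (\<lambda>(i, j). \<pi> (Suc i, Suc j)) {(i, j). i \<le> j \<and> j < m}"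
    for \<pi> :: "nat \<times> nat \<Rightarrow> nat"
  have forward: "diag \<pi> \<in> diagonals (psum r) n \<and> upper \<pi> \<in> triangles m (diag \<pi>) \<and>
      symmetric_array m (upper \<pi>) = \<pi> \<and> nondiag_size m \<pi> = 2 * upper_size m (upper \<pi>) \<and>
      diag_size m \<pi> = (\<Sum>i<m. diag \<pi> i)"
    if \<pi>: "\<pi> \<in> block_symmetric_pps n m r" for \<pi>
  proof -
    have sym: "\<forall>i\<in>{1..m}. \<forall>j\<in>{1..m}. \<pi> (i, j) = \<pi> (j, i)"
      and levels: "\<forall>i<m. \<pi> (Suc i, Suc i) \<in> {level (psum r) n i, Suc (level (psum r) n i)}"
      using \<pi> block_symmetric_iff_level by (auto simp: block_symmetric_pps_def m_def)
    have ext: "\<pi> \<in> extensional ({1..m} \<times> {1..m})"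
      using \<pi> by (auto simp: block_symmetric_pps_def plane_partitions_def PiE_iff)
    have row: "\<pi> (i, j') \<le> \<pi> (i, j)"
      if "i \<in> {1..m}" "j \<in> {1..m}" "j' \<in> {1..m}" "j \<le> j'" for i j j'
      using \<pi> that by (auto simp: block_symmetric_pps_def plane_partitions_def)
    have col: "\<pi> (i', j) \<le> \<pi> (i, j)"
      if "i \<in> {1..m}" "i' \<in> {1..m}" "j \<in> {1..m}" "i \<le> i'" for i i' j
      using \<pi> that by (auto simp: block_symmetric_pps_def plane_partitions_def)
    have "\<pi> (Suc j, Suc j) \<le> \<pi> (Suc i, Suc i)" if "i \<le> j" "j < m" for i j
      using row[of "Suc i" "Suc i" "Suc j"] col[of "Suc i" "Suc j" "Suc j"] that by simp
    hence "diag \<pi> \<in> diagonals (psum r) n"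
      using levels by (auto simp: diagonals_def diag_def m_def)
    moreover have "upper \<pi> \<in> triangles m (diag \<pi>)"
      unfolding triangles_def
    proof (intro CollectI conjI allI impI)
      show "upper \<pi> (i, j') \<le> upper \<pi> (i, j)" if "i \<le> j \<and> j \<le> j' \<and> j' < m" for i j j'
        using row[of "Suc i" "Suc j" "Suc j'"] that by (simp add: upper_def)
      show "upper \<pi> (i', j) \<le> upper \<pi> (i, j)" if "i \<le> i' \<and> i' \<le> j \<and> j < m" for i i' j
        using col[of "Suc i" "Suc i'" "Suc j"] that by (simp add: upper_def)
    qed (auto simp: upper_def diag_def)
    moreover have "symmetric_array m (upper \<pi>) = \<pi>"
    proof (rule extensionalityI[OF _ ext])
      show "symmetric_array m (upper \<pi>) \<in> extensional ({1..m} \<times> {1..m})"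
        by (simp add: symmetric_array_def)
      fix p assume p: "p \<in> {1..m} \<times> {1..m}"
      obtain i j where [simp]: "p = (i, j)"
        by (cases p)
      have "symmetric_array m (upper \<pi>) (i, j) = \<pi> (min i j, max i j)"
        using p by (auto simp: symmetric_array_def upper_def min_def max_def)
      also have "\<dots> = \<pi> (i, j)"
        using p sym by (auto simp: min_def max_def)
      finally show "symmetric_array m (upper \<pi>) p = \<pi> p"
        by simp
    qed
    moreover have "nondiag_size m \<pi> = 2 * upper_size m (upper \<pi>)"
      unfolding nondiag_size_symmetric[OF sym]
      by (intro arg_cong[of _ _ "(*) 2"] upper_size_cong) (simp add: upper_def)
    moreover have "diag_size m \<pi> = (\<Sum>i<m. diag \<pi> i)"
      unfolding diag_size_def
      by (rule sum.reindex_bij_witness[of _ Suc "\<lambda>i. i - 1"]) (auto simp: diag_def)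
    ultimately show ?thesis
      by blast
  qed
  have backward: "symmetric_array m T \<in> block_symmetric_pps n m r \<and>
      diag (symmetric_array m T) = a \<and> upper (symmetric_array m T) = T"
    if a: "a \<in> diagonals (psum r) n" and T: "T \<in> triangles m a" for a T
  proof -
    have "diag (symmetric_array m T) = a"
    proof (rule extensionalityI[of _ "{0..<m}"])
      show "a \<in> extensional {0..<m}"
        using a by (auto simp: diagonals_def m_def PiE_iff)
    qed (use T in \<open>auto simp: diag_def symmetric_array_Suc triangles_def\<close>)
    moreover have "upper (symmetric_array m T) = T"
    proof (rule extensionalityI[of _ "{(i, j). i \<le> j \<and> j < m}"])
      show "T \<in> extensional {(i, j). i \<le> j \<and> j < m}"
        using T by (auto simp: triangles_def PiE_iff)
    qed (auto simp: upper_def symmetric_array_Suc)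
    ultimately show ?thesis
      using symmetric_array_block_symmetric[OF assms a] T by (simp add: m_def)
  qed
  show ?thesis
    unfolding m_def[symmetric]
  proof (rule sum.reindex_bij_witness[of _ "\<lambda>(a, T). symmetric_array m T" "\<lambda>\<pi>. (diag \<pi>, upper \<pi>)"])
    fix \<pi> assume "\<pi> \<in> block_symmetric_pps n m r"
    note f = forward[OF this]
    show "(case (diag \<pi>, upper \<pi>) of (a, T) \<Rightarrow> symmetric_array m T) = \<pi>"
      "(diag \<pi>, upper \<pi>) \<in> (SIGMA a : diagonals (psum r) n. triangles m a)"
      using f by simp_all
    show "(case (diag \<pi>, upper \<pi>) of (a, T) \<Rightarrow> t ^ (\<Sum>i<m. a i) * (q\<^sup>2) ^ upper_size m T) =
        q ^ nondiag_size m \<pi> * t ^ diag_size m \<pi>"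
      using f by (simp add: power_mult mult.commute)
  next
    fix p assume "p \<in> (SIGMA a : diagonals (psum r) n. triangles m a)"
    then obtain a T where "p = (a, T)" "a \<in> diagonals (psum r) n" "T \<in> triangles m a"
      by blast
    thus "(diag (case p of (a, T) \<Rightarrow> symmetric_array m T),
        upper (case p of (a, T) \<Rightarrow> symmetric_array m T)) = p"
      "(case p of (a, T) \<Rightarrow> symmetric_array m T) \<in> block_symmetric_pps n m r"
      using backward by simp_all
  qed
qed


section \<open>Assembling the generating function\<close>

theorem sum_block_symmetric_pps_eq:
  fixes q t :: "'a :: field" and r :: "nat \<Rightarrow> nat"
  assumes "n \<ge> 1" "q \<noteq> 0" and q: "\<And>k. k > 0 \<Longrightarrow> q ^ k \<noteq> 1"
  defines "S \<equiv> psum r"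
  shows "(\<Sum>\<pi>\<in>block_symmetric_pps n (S n) r. q ^ nondiag_size (S n) \<pi> * t ^ diag_size (S n) \<pi>) =
    (\<Prod>i<S n. 1 + (q\<^sup>2) ^ i * t) * t ^ (\<Sum>i<S n. level S n i) *
    (alternant (q\<^sup>2) (S n) (level S n) / alternant (q\<^sup>2) (S n) (\<lambda>_. 0))"
proof -
  define V where "V = alternant (q\<^sup>2) (S n)"
  define P where "P = PiE {0..<S n} (\<lambda>i. {level S n i, Suc (level S n i)})"
  have antimono: "a (Suc i) \<le> a i" if "a \<in> diagonals S n" "Suc i < S n" for a i
    using that by (auto simp: diagonals_def)
  have "finite P"
    unfolding P_def by (rule finite_PiE) auto
  have "diagonals S n \<subseteq> P"
    by (auto simp: diagonals_def P_def)
  have "finite (diagonals S n)"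
    using \<open>finite P\<close> \<open>diagonals S n \<subseteq> P\<close> by (rule rev_finite_subset)

  \<comment> \<open>Since levels weakly decrease and choices exceed them by at most one, any
    adjacent ascent is by exactly one. Such alternants vanish, so the sum may be extended from
    \<open>diagonals S n\<close> to the product set \<open>P\<close>.\<close>
  have vanish: "V a = 0" if a: "a \<in> P - diagonals S n" for a
  proof -
    have mem: "a i \<in> {level S n i, Suc (level S n i)}" if "i < S n" for i
    proof -
      have "a \<in> PiE {0..<S n} (\<lambda>i. {level S n i, Suc (level S n i)})"
        using a by (simp add: P_def)
      from PiE_mem[OF this, of i] that show ?thesis
        by simp
    qed
    obtain i j where ij: "i \<le> j" "j < S n" "\<not> a j \<le> a i"
      using a by (auto simp: diagonals_def P_def)
    have "\<exists>i. Suc i < S n \<and> \<not> a (Suc i) \<le> a i"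
    proof (rule ccontr)
      assume "\<nexists>i. Suc i < S n \<and> \<not> a (Suc i) \<le> a i"
      with ij(1,2) have "a j \<le> a i"
        by (induction j rule: dec_induct) (auto intro: order_trans Suc_lessD)
      thus False
        using ij(3) by simp
    qed
    then obtain i where i: "Suc i < S n" "\<not> a (Suc i) \<le> a i"
      by blast
    have "a (Suc i) = Suc (a i)"
      using mem[of i] mem[of "Suc i"] level_antimono[of i "Suc i" S n] i by auto
    thus ?thesis
      unfolding V_def using i(1) by (rule alternant_eq_0[rotated])
  qed

  have "V (\<lambda>_. 0) \<noteq> 0"
    unfolding V_def
  proof (rule alternant_zero_nonzero)
    show "(q\<^sup>2) ^ k \<noteq> 1" if "k > 0" for k
      using q[of "2 * k"] that by (simp add: power_mult)
  qed (use assms(2) in simp)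
  have "(\<Sum>\<pi>\<in>block_symmetric_pps n (S n) r. q ^ nondiag_size (S n) \<pi> * t ^ diag_size (S n) \<pi>) =
      (\<Sum>(a, T)\<in>(SIGMA a : diagonals S n. triangles (S n) a).
        t ^ (\<Sum>i<S n. a i) * (q\<^sup>2) ^ upper_size (S n) T)"
    unfolding S_def by (rule sum_block_symmetric_pps[OF assms(1)])
  also have "\<dots> = (\<Sum>a\<in>diagonals S n. \<Sum>T\<in>triangles (S n) a.
      t ^ (\<Sum>i<S n. a i) * (q\<^sup>2) ^ upper_size (S n) T)"
    using \<open>finite (diagonals S n)\<close>
    by (rule sum.Sigma[symmetric]) (intro ballI finite_triangles antimono)
  also have "\<dots> * V (\<lambda>_. 0) = (\<Sum>a\<in>diagonals S n. t ^ (\<Sum>i<S n. a i) * V a)"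
    unfolding sum_distrib_right
  proof (rule sum.cong[OF refl])
    fix a assume "a \<in> diagonals S n"
    hence "V a = (\<Sum>T\<in>triangles (S n) a. (q\<^sup>2) ^ upper_size (S n) T) * V (\<lambda>_. 0)"
      unfolding V_def by (intro sum_triangles_alternant[symmetric] antimono)
    thus "(\<Sum>T\<in>triangles (S n) a.
        t ^ (\<Sum>i<S n. a i) * (q\<^sup>2) ^ upper_size (S n) T * V (\<lambda>_. 0)) = t ^ (\<Sum>i<S n. a i) * V a"
      by (simp only: sum_distrib_left sum_distrib_right mult.assoc)
  qed
  also have "\<dots> = (\<Sum>a\<in>P. t ^ (\<Sum>i<S n. a i) * V a)"
    using \<open>finite P\<close> \<open>diagonals S n \<subseteq> P\<close> vanish by (intro sum.mono_neutral_left) auto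
  also have "\<dots> = (\<Prod>i<S n. 1 + (q\<^sup>2) ^ i * t) * t ^ (\<Sum>i<S n. level S n i) * V (level S n)"
    unfolding P_def V_def by (rule sum_alternant_vertical_strips)
  finally show ?thesis
    using \<open>V (\<lambda>_. 0) \<noteq> 0\<close> unfolding V_def times_divide_eq_right by (intro eq_divide_imp)
qed

lemma q_var_power: "q_var ^ k = Fract [:monom 1 k:] 1"
proof (induction k)
  case (Suc k)
  have "[:0, 1:] * monom 1 k = (monom 1 (Suc k) :: int poly)"
    by (simp add: monom_Suc)
  thus ?case
    unfolding power_Suc Suc.IH by (simp add: q_var_def)
qed (simp add: One_fract_def one_pCons)

theorem theorem2p7:
  fixes m n :: nat and r :: "nat \<Rightarrow> nat" and S :: "nat \<Rightarrow> nat"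
    and \<alpha> \<beta> :: nat and q t :: ratfun
  assumes "m \<ge> 1" and "n \<ge> 1"
    and "(\<Sum>i = 1..n. r i) = m"
  defines "S \<equiv> psum r"
    and "\<alpha> \<equiv> (\<Sum>i = 1..n. (S n - S i) choose 2)"
    and "\<beta> \<equiv> (\<Sum>i = 1..n. S n - S i)"
    and "q \<equiv> q_var" and "t \<equiv> t_var"
  shows "(\<Sum>\<pi> \<in> block_symmetric_pps n m r. q ^ nondiag_size m \<pi> * t ^ diag_size m \<pi>) =
    (\<Prod>i = 1..m. 1 + q ^ (2 * i - 2) * t) * q ^ (2 * \<alpha>) * t ^ \<beta> *
    (((\<Prod>(i, j) \<in> {(i, j). 1 \<le> i \<and> i < j \<and> j \<le> n}. qnum (q\<^sup>2) (S j - S i + (j - i))) *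
      (\<Prod>i = 1..n. qfact (q\<^sup>2) (S n + i - 1))) /
     (\<Prod>i = 1..n. qfact (q\<^sup>2) (S i + i - 1) * qfact (q\<^sup>2) (S n - S i + (n - i))))"
proof -
  have m: "S n = m"
    using assms(3) by (simp add: S_def psum_def)
  \<comment> \<open>The indeterminate is not a root of unity, by comparison of polynomial degrees;
    this keeps every denominator nonzero.\<close>
  have q_power: "q ^ k \<noteq> 1" if "k > 0" for k
  proof
    assume "q ^ k = 1"
    hence "monom 1 k = (1 :: int poly)"
      by (simp add: q_def q_var_power One_fract_def eq_fract one_pCons)
    thus False
      using that degree_monom_eq[of "1 :: int" k] by simp
  qed
  have "q \<noteq> 0"
    by (simp add: q_def q_var_def Zero_fract_def eq_fract)
  have u_power: "(q\<^sup>2) ^ k \<noteq> 1" if "k > 0" for k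
    using q_power[of "2 * k"] that by (simp add: power_mult)
  have S: "mono S" "S 0 = 0"
    by (simp_all add: S_def mono_psum psum_def)
  have \<beta>: "(\<Sum>i<S n. level S n i) = \<beta>"
    using sum_level_weighted[where f = "\<lambda>_. 1" and S = S and n = n] by (simp add: \<beta>_def)
  let ?X = "((\<Prod>(i, j) \<in> {(i, j). 1 \<le> i \<and> i < j \<and> j \<le> n}. qnum (q\<^sup>2) (S j - S i + (j - i))) *
      (\<Prod>i = 1..n. qfact (q\<^sup>2) (S n + i - 1))) /
     (\<Prod>i = 1..n. qfact (q\<^sup>2) (S i + i - 1) * qfact (q\<^sup>2) (S n - S i + (n - i)))"
  have "alternant (q\<^sup>2) (S n) (level S n) =
      alternant (q\<^sup>2) (S n) (\<lambda>_. 0) * (q\<^sup>2) ^ \<alpha> * ?X"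
    unfolding \<alpha>_def using \<open>q \<noteq> 0\<close> u_power
    by (intro alternant_level[OF S]) simp_all
  moreover have "alternant (q\<^sup>2) (S n) (\<lambda>_. 0) \<noteq> 0"
    using \<open>q \<noteq> 0\<close> u_power by (intro alternant_zero_nonzero) simp_all
  ultimately have ratio: "alternant (q\<^sup>2) (S n) (level S n) / alternant (q\<^sup>2) (S n) (\<lambda>_. 0) =
      q ^ (2 * \<alpha>) * ?X"
    by (simp only: power_mult nonzero_mult_div_cancel_left mult.assoc not_False_eq_True)
  have factors: "(\<Prod>i<S n. 1 + (q\<^sup>2) ^ i * t) = (\<Prod>i = 1..m. 1 + q ^ (2 * i - 2) * t)"
    unfolding m by (rule prod.reindex_bij_witness[of _ "\<lambda>i. i - 1" Suc])
      (auto simp: right_diff_distrib' simp flip: power_mult)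
  show ?thesis
    using sum_block_symmetric_pps_eq[OF assms(2) \<open>q \<noteq> 0\<close> q_power, of r t, folded S_def]
    unfolding ratio factors \<beta> unfolding m by (simp only: mult_ac)
qed

end
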